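(* Let $n\ge 6$ be even and let $C$ be the outer cycle of the Wagner graph $V_n$. Then $\sum_{e\in E(C)}x_e\le 4$ defines a facet of $\textsc{Bond}(V_n)$.
   Context: For even $n$, the (generalized) Wagner graph $V_n$ is obtained from the cycle $C_n$ on vertices $1,\dots,n$ (in cyclic order) by adding the edges $\{i,i+\tfrac n2\}$ for $1\le i\le \tfrac n2$; this $C_n$ is its outer cycle. For a graph $G=(V,E)$ and $S\subseteq V$, the cut $\delta(S)=\{e\in E:|e\cap S|=1\}$ is a bond if $G[S]$ and $G[V\setminus S]$ are connected. $x^\delta$ is the incidence vector, $\textsc{Bond}(G)=\mathrm{conv}\{x^\delta:\delta\text{ a bond}\}$. *)

theory Defs
  imports "HOL-Analysis.Analysis"
begin

definition outer_cycle :: "nat \<Rightarrow> nat set set" where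
  "outer_cycle n = {{i, i mod n + 1} | i. i \<in> {1..n}}"

definition wagner_verts :: "nat \<Rightarrow> nat set" where
  "wagner_verts n = {1..n}"

definition wagner_edges :: "nat \<Rightarrow> nat set set" where
  "wagner_edges n = outer_cycle n \<union> {{i, i + n div 2} | i. i \<in> {1..n div 2}}"

definition cut :: "'v set set \<Rightarrow> 'v set \<Rightarrow> 'v set set" where
  "cut E S = {e \<in> E. card (e \<inter> S) = 1}"

text \<open>Connectedness of the subgraph induced by \<open>S\<close>. The empty graph counts as connected, so the
  empty cut is a bond of a connected graph.\<close>
definition induced_connected :: "'v set set \<Rightarrow> 'v set \<Rightarrow> bool" where
  "induced_connected E S \<longleftrightarrow>
     (\<forall>u\<in>S. \<forall>v\<in>S. (u, v) \<in> {(a, b). a \<in> S \<and> b \<in> S \<and> {a, b} \<in> E}\<^sup>*)"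

definition is_bond :: "'v set \<Rightarrow> 'v set set \<Rightarrow> 'v set set \<Rightarrow> bool" where
  "is_bond V E D \<longleftrightarrow>
     (\<exists>S\<subseteq>V. D = cut E S \<and> induced_connected E S \<and> induced_connected E (V - S))"

text \<open>The space of real vectors indexed by \<open>E\<close> is \<open>real ^ 'e\<close>, where \<open>ix\<close> is a bijection from \<open>E\<close>
  onto the index type \<open>'e\<close>: the coordinate \<open>x\<^sub>e\<close> of \<open>x\<close> is \<open>x $ ix e\<close>.\<close>
definition incidence_vec :: "('v set \<Rightarrow> 'e::finite) \<Rightarrow> 'v set set \<Rightarrow> real ^ 'e" where
  "incidence_vec ix D = (\<chi> j. if j \<in> ix ` D then 1 else 0)"

definition bond_polytope ::
  "('v set \<Rightarrow> 'e::finite) \<Rightarrow> 'v set \<Rightarrow> 'v set set \<Rightarrow> (real ^ 'e) set" where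
  "bond_polytope ix V E = convex hull {incidence_vec ix D | D. is_bond V E D}"

text \<open>The inequality \<open>f x \<le> b\<close>, with \<open>f\<close> linear, is valid on \<open>P\<close> and its set of tight points is a
  facet of \<open>P\<close>.\<close>
definition defines_facet :: "('a::euclidean_space \<Rightarrow> real) \<Rightarrow> real \<Rightarrow> 'a set \<Rightarrow> bool" where
  "defines_facet f b P \<longleftrightarrow> (\<forall>x\<in>P. f x \<le> b) \<and> {x \<in> P. f x = b} facet_of P"

end

theory Submission
  imports Defs
begin

text \<open>
  Write \<open>n = 2k\<close>. Validity: if one side of a bond contains no chord, it is an arc of the outer cycle
  and the bond has at most two outer edges. Otherwise let \<open>{v, v + k}\<close> be a chord inside \<open>S\<close> and
  \<open>{w, w + k}\<close> a chord inside the complement \<open>T\<close>; they cut the cycle into four arcs, each running from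
  \<open>S\<close> to \<open>T\<close> or back. If membership changed more than once along the arc from \<open>v\<close> to \<open>w\<close>, then
  connectedness would yield chords \<open>z' < z\<close> strictly between \<open>v\<close> and \<open>w\<close> with \<open>z'\<close> in \<open>T\<close> and \<open>z\<close>
  in \<open>S\<close>; but then the \<open>T\<close>-chords \<open>z'\<close> and \<open>w\<close> separate the \<open>S\<close>-chords \<open>z\<close> and \<open>v\<close> in \<open>V\<^sub>n\<close>.
  So there are at most four changes.

  Dimension: since \<open>0\<close> is a vertex off the hyperplane, it suffices that the tight bonds span the
  whole space. A vector orthogonal to the bonds with
  \<open>S = {v, v + k}\<close>, \<open>{v, v + 1, v + k}\<close> and \<open>{v, v + 1, v + k, v + k + 1}\<close> is zero.
\<close>

section \<open>Facet criterion and tools for sequences and connectedness\<close>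

text \<open>By \<open>orth\<close> the tight points span the space, since a proper subspace has a
  nonzero normal. Adjoining \<open>0\<close> raises their affine dimension by at most one, so it was
  at least \<open>DIM('a) - 1\<close>; the point \<open>z\<close> makes the face proper.\<close>

lemma facet_of_supporting_hyperplane:
  fixes P :: "'a::euclidean_space set"
  assumes "convex P" and le: "\<And>x. x \<in> P \<Longrightarrow> c \<bullet> x \<le> b"
    and z: "z \<in> P" "c \<bullet> z \<noteq> b"
    and orth: "\<And>a. (\<And>x. x \<in> P \<Longrightarrow> c \<bullet> x = b \<Longrightarrow> a \<bullet> x = 0) \<Longrightarrow> a = 0"
  shows "{x \<in> P. c \<bullet> x = b} facet_of P"
proof -
  define F where "F = {x \<in> P. c \<bullet> x = b}"
  have F_Int: "F = P \<inter> {x. c \<bullet> x = b}"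
    unfolding F_def by auto
  have face: "F face_of P"
    unfolding F_Int by (rule face_of_Int_supporting_hyperplane_le[OF assms(1) le])
  have "F \<noteq> P"
    using z unfolding F_def by auto
  then have lt: "aff_dim F < aff_dim P"
    using face_of_aff_dim_lt[OF assms(1) face] by simp
  have dimF: "dim F = DIM('a)"
  proof (rule ccontr)
    assume "dim F \<noteq> DIM('a)"
    then have "dim F < DIM('a)"
      using dim_subset_UNIV[of F] by simp
    then obtain a where a: "a \<noteq> 0" "span F \<subseteq> {x. a \<bullet> x = 0}"
      using lowdim_subset_hyperplane by blast
    have "a = 0"
    proof (rule orth)
      fix x assume "x \<in> P" "c \<bullet> x = b"
      then have "x \<in> span F"
        unfolding F_def by (simp add: span_base)
      then show "a \<bullet> x = 0" using a(2) by auto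
    qed
    with a(1) show False by simp
  qed
  have "aff_dim (insert 0 F) = int (dim (insert 0 F))"
    by (rule aff_dim_zero) (simp add: hull_inc)
  then have "aff_dim (insert 0 F) = int DIM('a)"
    using dimF by (simp add: dim_insert span_0)
  then have ge: "aff_dim F \<ge> int DIM('a) - 1"
    by (auto simp: aff_dim_insert split: if_splits)
  moreover have "aff_dim P \<le> int DIM('a)"
    by (rule aff_dim_le_DIM)
  ultimately have "aff_dim F = aff_dim P - 1"
    using lt by linarith
  moreover have "F \<noteq> {}"
    using dimF DIM_positive[where 'a='a] by (metis dim_empty less_irrefl)
  ultimately show ?thesis
    using face unfolding F_def facet_of_def by blast
qed

text \<open>Sliding the window by one trades \<open>v\<close> for \<open>v + m\<close>, where
  \<open>f\<close> has the same value. Enumerations of cyclic data may thus start anywhere.\<close>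

lemma periodic_image_window:
  fixes f :: "nat \<Rightarrow> 'a"
  assumes "m > 0" and per: "\<And>i. f (i + m) = f i"
  shows "f ` {v..<v + m} = range f"
proof (induction v)
  case 0
  have mult: "f (i + q * m) = f i" for i q
    by (induction q) (use per in \<open>auto simp: add.assoc[symmetric] add.commute[of m]\<close>)
  have "f i \<in> f ` {0..<0 + m}" for i
    using mult[of "i mod m" "i div m"] assms(1) by (metis imageI atLeastLessThan_iff le0
        mod_less_divisor mod_div_mult_eq add_0)
  then show ?case by auto
next
  case (Suc v)
  have 1: "{v..<v + m} = insert v {Suc v..<v + m}"
    and 2: "{Suc v..<Suc v + m} = insert (v + m) {Suc v..<v + m}"
    using assms(1) by auto
  have "f ` {Suc v..<Suc v + m} = f ` {v..<v + m}"
    unfolding 1 2 by (simp add: per)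
  with Suc show ?case by simp
qed

text \<open>The hypothesis makes the final value \<open>s b\<close> absorbing, so the only possible
  change is the one that reaches it.\<close>

lemma card_changes_le_1:
  fixes s :: "nat \<Rightarrow> bool"
  assumes "\<And>x y. a \<le> x \<Longrightarrow> x < y \<Longrightarrow> y \<le> b \<Longrightarrow> s x = s b \<Longrightarrow> s y = s b"
  shows "card {i \<in> {a..<b}. s i \<noteq> s (Suc i)} \<le> 1"
proof -
  have no_two: "False"
    if "i < j" "i \<in> {i \<in> {a..<b}. s i \<noteq> s (Suc i)}" "j \<in> {i \<in> {a..<b}. s i \<noteq> s (Suc i)}" for i j
  proof -
    have i: "a \<le> i" "i < b" "s i \<noteq> s (Suc i)" and j: "j < b" "s j \<noteq> s (Suc j)"
      using that by auto
    have "s (Suc i) = s b"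
      using assms[of i "Suc i"] i by auto
    then have "s j = s b"
      using assms[of "Suc i" j] i j that(1) by (cases "Suc i = j") auto
    then show False
      using assms[of j "Suc j"] i j that(1) by auto
  qed
  have "i = j" if "i \<in> {i \<in> {a..<b}. s i \<noteq> s (Suc i)}" "j \<in> {i \<in> {a..<b}. s i \<noteq> s (Suc i)}" for i j
    using no_two[OF _ that] no_two[OF _ that(2,1)] by (metis linorder_neqE_nat)
  then show ?thesis
    by (simp add: card_le_Suc0_iff_eq)
qed

text \<open>This is how a connected side is exploited: a set \<open>U\<close> closed under
  neighbours in \<open>S\<close> traps every path in \<open>S\<close> that starts in it.\<close>

lemma induced_connected_closedD:
  assumes "induced_connected E S" "u \<in> S" "v \<in> S" "u \<in> U"
    and closed: "\<And>a b. a \<in> U \<Longrightarrow> b \<in> S \<Longrightarrow> {a, b} \<in> E \<Longrightarrow> b \<in> U"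
  shows "v \<in> U"
proof -
  have "(u, v) \<in> {(a, b). a \<in> S \<and> b \<in> S \<and> {a, b} \<in> E}\<^sup>*"
    using assms(1-3) unfolding induced_connected_def by blast
  then show ?thesis
    by (induction) (use assms in auto)
qed

lemma induced_connected_hub:
  assumes "\<And>u. u \<in> S \<Longrightarrow> (u, h) \<in> {(a, b). a \<in> S \<and> b \<in> S \<and> {a, b} \<in> E}\<^sup>*"
  shows "induced_connected E S"
proof -
  have "sym ({(a, b). a \<in> S \<and> b \<in> S \<and> {a, b} \<in> E}\<^sup>*)"
    by (intro sym_rtrancl symI) (auto simp: insert_commute)
  then show ?thesis
    unfolding induced_connected_def using assms by (meson rtrancl_trans symD)
qed

lemma card_doubleton_Int_eq_1:
  assumes "a \<noteq> b"
  shows "card ({a, b} \<inter> S) = 1 \<longleftrightarrow> (a \<in> S) \<noteq> (b \<in> S)"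
  using assms by (auto simp: Int_insert_left)

section \<open>The Wagner graph in cyclic coordinates\<close>

locale wagner =
  fixes k n :: nat
  assumes k: "k \<ge> 3" and n: "n = 2 * k"
begin

\<comment> \<open>Inequalities only: with an equation for \<open>n\<close> among the facts, \<open>auto\<close> would eliminate \<open>n\<close> from the
  locale constants.\<close>
lemma sizes: "3 \<le> k" "k + k \<le> n" "n \<le> k + k"
  using k n by auto

text \<open>Positions run through all natural numbers and wrap around with period \<open>n\<close>,
  so an arc passing vertex \<open>n\<close> is still an interval. Chords have period
  \<open>k\<close>.\<close>

definition vx :: "nat \<Rightarrow> nat" where "vx i = i mod n + 1"
definition cyc :: "nat \<Rightarrow> nat set" where "cyc i = {vx i, vx (Suc i)}"
definition chd :: "nat \<Rightarrow> nat set" where "chd i = {vx i, vx (i + k)}"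

lemma vx_add_n [simp]: "vx (i + n) = vx i"
  by (simp add: vx_def)

lemma vx_add_k_k [simp]: "vx (i + k + k) = vx i"
  using vx_add_n[of i] by (simp add: n mult_2 add.assoc)

lemma vx_eq_iff_dvd: "i \<le> j \<Longrightarrow> vx i = vx j \<longleftrightarrow> n dvd j - i"
  unfolding vx_def using mod_eq_dvd_iff_nat[of i j n] by auto

lemma vx_neq: "i < j \<Longrightarrow> j < i + n \<Longrightarrow> vx i \<noteq> vx j"
  by (auto simp: vx_eq_iff_dvd dest!: dvd_imp_le)

lemma vx_inj_window: "vx i = vx j \<Longrightarrow> i < j + n \<Longrightarrow> j < i + n \<Longrightarrow> i = j"
  using vx_neq[of i j] vx_neq[of j i] by (metis linorder_neqE_nat)

lemma vx_add_cong: "vx i = vx j \<Longrightarrow> vx (i + m) = vx (j + m)"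
  unfolding vx_def by (metis add_right_cancel mod_add_cong)

lemma vx_Suc_cong: "vx i = vx j \<Longrightarrow> vx (Suc i) = vx (Suc j)"
  using vx_add_cong[of i j 1] by simp

lemma cyc_add_n [simp]: "cyc (i + n) = cyc i"
  using vx_add_n[of "Suc i"] by (simp add: cyc_def)

lemma chd_add_k [simp]: "chd (i + k) = chd i"
  by (simp add: chd_def insert_commute)

lemma verts_window: "wagner_verts n = vx ` {v..<v + n}"
proof -
  have "wagner_verts n = vx ` {0..<0 + n}"
  proof
    show "wagner_verts n \<subseteq> vx ` {0..<0 + n}"
    proof
      fix x assume "x \<in> wagner_verts n"
      then have "x = vx (x - 1)" "x - 1 \<in> {0..<0 + n}"
        by (auto simp: wagner_verts_def vx_def)
      then show "x \<in> vx ` {0..<0 + n}" by blast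
    qed
  next
    have "i mod n < n" for i using sizes by simp
    then show "vx ` {0..<0 + n} \<subseteq> wagner_verts n"
      by (auto simp: wagner_verts_def vx_def Suc_leI)
  qed
  then show ?thesis
    using periodic_image_window[of n vx 0] periodic_image_window[of n vx v] sizes by simp
qed

lemma outer_window: "outer_cycle n = cyc ` {v..<v + n}"
proof -
  have "outer_cycle n = (\<lambda>i. {i, i mod n + 1}) ` wagner_verts n"
    unfolding outer_cycle_def wagner_verts_def by auto
  also have "\<dots> = cyc ` {v..<v + n}"
    unfolding verts_window[of v] image_image cyc_def vx_def by (simp add: mod_Suc_eq)
  finally show ?thesis .
qed

lemma chords_window: "{{i, i + n div 2} | i. i \<in> {1..n div 2}} = chd ` {v..<v + k}"
proof -
  have "{{i, i + n div 2} | i. i \<in> {1..n div 2}} = (\<lambda>i. {i, i + k}) ` {1..k}"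
    unfolding n by auto
  also have "{1..k} = Suc ` {0..<k}"
    by (simp add: atLeastLessThanSuc_atLeastAtMost)
  also have "(\<lambda>i. {i, i + k}) ` Suc ` {0..<k} = chd ` {0..<0 + k}"
    unfolding image_image by (rule image_cong) (use sizes in \<open>auto simp: chd_def vx_def\<close>)
  also have "\<dots> = chd ` {v..<v + k}"
    using periodic_image_window[of k chd 0] periodic_image_window[of k chd v] k by simp
  finally show ?thesis .
qed

lemma edges_window: "wagner_edges n = cyc ` {v..<v + n} \<union> chd ` {v..<v + k}"
  unfolding wagner_edges_def outer_window[of v] chords_window[of v] ..

lemma cyc_in_edges: "cyc i \<in> wagner_edges n"
  and chd_in_edges: "chd i \<in> wagner_edges n"
  using sizes by (auto simp: edges_window[of i])

lemma outer_subset_edges: "outer_cycle n \<subseteq> wagner_edges n"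
  by (auto simp: wagner_edges_def)

lemma finite_edges: "finite (wagner_edges n)"
  by (simp add: edges_window[of 0])

lemma inj_cyc: "inj_on cyc {v..<v + n}"
proof (rule linorder_inj_onI')
  fix i j assume ij: "i \<in> {v..<v + n}" "j \<in> {v..<v + n}" "i < j"
  have "vx i \<noteq> vx j" using ij by (intro vx_neq) auto
  moreover have "\<not> (vx i = vx (Suc j) \<and> vx (Suc i) = vx j)"
  proof
    assume *: "vx i = vx (Suc j) \<and> vx (Suc i) = vx j"
    then have "Suc i = j"
      using vx_inj_window[of "Suc i" j] ij by auto
    with * vx_neq[of i "Suc j"] k n show False by auto
  qed
  ultimately show "cyc i \<noteq> cyc j"
    by (auto simp: cyc_def doubleton_eq_iff)
qed

lemma inj_chd: "inj_on chd {v..<v + k}"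
proof (rule linorder_inj_onI')
  fix i j assume ij: "i \<in> {v..<v + k}" "j \<in> {v..<v + k}" "i < j"
  have "vx i \<noteq> vx j" using ij sizes by (intro vx_neq) auto
  moreover have "vx j \<noteq> vx (i + k)" using ij sizes by (intro vx_neq) auto
  ultimately show "chd i \<noteq> chd j"
    by (auto simp: chd_def doubleton_eq_iff)
qed

lemma cyc_neq_chd: "cyc i \<noteq> chd j"
proof
  assume "cyc i = chd j"
  then consider "vx i = vx j" "vx (Suc i) = vx (j + k)" | "vx i = vx (j + k)" "vx (Suc i) = vx j"
    by (auto simp: cyc_def chd_def doubleton_eq_iff)
  then show False
  proof cases
    case 1
    then have "vx (Suc j) = vx (j + k)" using vx_Suc_cong by metis
    then show False using vx_neq[of "Suc j" "j + k"] sizes by auto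
  next
    case 2
    then have "vx (Suc (j + k)) = vx j" using vx_Suc_cong by metis
    then show False using vx_neq[of j "Suc (j + k)"] sizes by auto
  qed
qed

lemma cyc_in_cut: "cyc i \<in> cut (wagner_edges n) S \<longleftrightarrow> (vx i \<in> S) \<noteq> (vx (Suc i) \<in> S)"
proof -
  have "vx i \<noteq> vx (Suc i)" using sizes by (intro vx_neq) auto
  then show ?thesis
    using cyc_in_edges[of i] card_doubleton_Int_eq_1[of "vx i" "vx (Suc i)" S]
    unfolding cut_def cyc_def by blast
qed

lemma chd_in_cut: "chd i \<in> cut (wagner_edges n) S \<longleftrightarrow> (vx i \<in> S) \<noteq> (vx (i + k) \<in> S)"
proof -
  have "vx i \<noteq> vx (i + k)" using sizes by (intro vx_neq) auto
  then show ?thesis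
    using chd_in_edges[of i] card_doubleton_Int_eq_1[of "vx i" "vx (i + k)" S]
    unfolding cut_def chd_def by blast
qed

text \<open>A cut edge of the cycle is recorded by its first position, with \<open>b\<close>
  excluded, so counts over consecutive intervals add up and a window of length \<open>n\<close> sees
  each outer edge once.\<close>

definition crossings :: "nat set \<Rightarrow> nat \<Rightarrow> nat \<Rightarrow> nat set" where
  "crossings S a b = {i \<in> {a..<b}. (vx i \<in> S) \<noteq> (vx (Suc i) \<in> S)}"

lemma outer_Int_cut:
  "outer_cycle n \<inter> cut (wagner_edges n) S = cyc ` crossings S v (v + n)"
  unfolding outer_window[of v] crossings_def using cyc_in_cut by blast

lemma card_outer_cut:
  "card (outer_cycle n \<inter> cut (wagner_edges n) S) = card (crossings S v (v + n))"
  unfolding outer_Int_cut[of S v]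
  by (intro card_image inj_on_subset[OF inj_cyc[of v]]) (auto simp: crossings_def)

lemma sum_cut:
  fixes h :: "nat set \<Rightarrow> real"
  shows "sum h (cut (wagner_edges n) S) =
    (\<Sum>i\<in>crossings S v (v + n). h (cyc i)) +
    (\<Sum>i\<in>{i \<in> {v..<v + k}. (vx i \<in> S) \<noteq> (vx (i + k) \<in> S)}. h (chd i))"
proof -
  let ?A = "crossings S v (v + n)"
  let ?B = "{i \<in> {v..<v + k}. (vx i \<in> S) \<noteq> (vx (i + k) \<in> S)}"
  have sub: "cut (wagner_edges n) S \<subseteq> wagner_edges n"
    by (auto simp: cut_def)
  have "cut (wagner_edges n) S = cyc ` ?A \<union> chd ` ?B"
  proof
    show "cut (wagner_edges n) S \<subseteq> cyc ` ?A \<union> chd ` ?B"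
    proof
      fix e assume e: "e \<in> cut (wagner_edges n) S"
      then consider i where "i \<in> {v..<v + n}" "e = cyc i" | i where "i \<in> {v..<v + k}" "e = chd i"
        using sub edges_window[of v] by blast
      then show "e \<in> cyc ` ?A \<union> chd ` ?B"
      proof cases
        case (1 i)
        then have "i \<in> ?A" using e cyc_in_cut unfolding crossings_def by blast
        with 1 show ?thesis by blast
      next
        case (2 i)
        then have "i \<in> ?B" using e chd_in_cut by blast
        with 2 show ?thesis by blast
      qed
    qed
    show "cyc ` ?A \<union> chd ` ?B \<subseteq> cut (wagner_edges n) S"
      by (auto simp: cyc_in_cut chd_in_cut crossings_def)
  qed
  moreover have "sum h (cyc ` ?A \<union> chd ` ?B) = sum h (cyc ` ?A) + sum h (chd ` ?B)"
    using cyc_neq_chd by (intro sum.union_disjoint) (auto simp: crossings_def)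
  moreover have "sum h (cyc ` ?A) = (\<Sum>i\<in>?A. h (cyc i))"
    by (intro sum.reindex_cong[of cyc] inj_on_subset[OF inj_cyc[of v]]) (auto simp: crossings_def)
  moreover have "sum h (chd ` ?B) = (\<Sum>i\<in>?B. h (chd i))"
    by (intro sum.reindex_cong[of chd] inj_on_subset[OF inj_chd[of v]]) auto
  ultimately show ?thesis by simp
qed

section \<open>Validity: at most four outer edges in a bond\<close>

lemma neighbour_cases:
  assumes "{vx j, u} \<in> wagner_edges n" "0 < j"
  shows "u = vx (Suc j) \<or> u = vx (j - 1) \<or> u = vx (j + k)"
proof -
  consider i where "{vx j, u} = cyc i" | i where "{vx j, u} = chd i"
    using assms(1) unfolding edges_window[of 0] by blast
  then show ?thesis
  proof cases
    case 1
    then consider "vx j = vx i" "u = vx (Suc i)" | "vx j = vx (Suc i)" "u = vx i"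
      by (auto simp: cyc_def doubleton_eq_iff)
    then show ?thesis
    proof cases
      case 1
      then show ?thesis using vx_Suc_cong by metis
    next
      case 2
      have "vx (j - 1) = vx (j + (n - 1))"
        using vx_add_n[of "j - 1"] assms(2) sizes by simp
      also have "\<dots> = vx (Suc i + (n - 1))"
        using 2 by (intro vx_add_cong) simp
      also have "\<dots> = vx i"
        using vx_add_n[of i] sizes by simp
      finally show ?thesis using 2 by simp
    qed
  next
    case 2
    then consider "vx j = vx i" "u = vx (i + k)" | "vx j = vx (i + k)" "u = vx i"
      by (auto simp: chd_def doubleton_eq_iff)
    then show ?thesis
      using vx_add_cong[of j _ k] by cases (metis, metis vx_add_k_k)
  qed
qed

text \<open>Both ends of the arc from \<open>a\<close> to \<open>b\<close> lie outside
  \<open>S\<close>, so a path in \<open>S\<close> from \<open>y\<close> to \<open>v\<close> can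
  leave its interior only by a chord. The alternatives for \<open>v\<close> place it on the
  complementary arc, counted after \<open>b\<close> or before \<open>a\<close>.\<close>

lemma chord_in_open_arc:
  assumes con: "induced_connected (wagner_edges n) S"
    and ab: "vx a \<notin> S" "vx b \<notin> S" and y: "a < y" "y < b" "vx y \<in> S"
    and v: "vx v \<in> S" "b \<le> v \<and> v \<le> a + n \<or> v \<le> a \<and> b \<le> v + n"
  shows "\<exists>z. a < z \<and> z < b \<and> vx z \<in> S \<and> vx (z + k) \<in> S"
proof (rule ccontr)
  assume no: "\<not> ?thesis"
  have "vx v \<in> {vx j | j. a < j \<and> j < b \<and> vx j \<in> S}"
  proof (rule induced_connected_closedD[OF con y(3) v(1)])
    show "vx y \<in> {vx j | j. a < j \<and> j < b \<and> vx j \<in> S}" using y by blast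
  next
    fix p q assume "p \<in> {vx j | j. a < j \<and> j < b \<and> vx j \<in> S}" "q \<in> S" "{p, q} \<in> wagner_edges n"
    then obtain j where j: "p = vx j" "a < j" "j < b" "vx j \<in> S" by blast
    have "q = vx (Suc j) \<or> q = vx (j - 1) \<or> q = vx (j + k)"
      using neighbour_cases[of j q] j \<open>{p, q} \<in> wagner_edges n\<close> by auto
    moreover have "q \<noteq> vx (j + k)"
      using no j \<open>q \<in> S\<close> by blast
    moreover have "a \<le> Suc j" "Suc j \<le> b" "a \<le> j - 1" "j - 1 \<le> b"
      using j by auto
    ultimately obtain i where i: "q = vx i" "a \<le> i" "i \<le> b"
      by metis
    moreover have "i \<noteq> a" "i \<noteq> b" using i ab \<open>q \<in> S\<close> by auto
    ultimately show "q \<in> {vx j | j. a < j \<and> j < b \<and> vx j \<in> S}"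
      using \<open>q \<in> S\<close> by (metis (mono_tags, lifting) mem_Collect_eq order_le_less)
  qed
  then obtain j where "vx v = vx j" "a < j" "j < b" by blast
  then show False using vx_inj_window[of v j] v(2) by auto
qed

text \<open>Chords exchange the two open arcs between the chords at \<open>a\<close> and
  \<open>b\<close>, and cycle edges leave these arcs only at the four chord ends, none of which is
  in \<open>S\<close>. So \<open>S\<close> cannot connect \<open>y\<close> inside to
  \<open>v\<close> outside.\<close>

lemma no_alternating_chords:
  assumes con: "induced_connected (wagner_edges n) S"
    and a: "vx a \<notin> S" "vx (a + k) \<notin> S" and b: "vx b \<notin> S" "vx (b + k) \<notin> S"
    and y: "a < y" "y < b" "vx y \<in> S" and v: "v < a" "b < v + k" "vx v \<in> S"
  shows False
proof -
  let ?U = "{vx j | j. (a < j \<and> j < b \<or> a + k < j \<and> j < b + k) \<and> vx j \<in> S}"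
  have "vx v \<in> ?U"
  proof (rule induced_connected_closedD[OF con y(3) v(3)])
    show "vx y \<in> ?U" using y by blast
  next
    fix p q assume "p \<in> ?U" "q \<in> S" "{p, q} \<in> wagner_edges n"
    then obtain j where j: "p = vx j" "a < j \<and> j < b \<or> a + k < j \<and> j < b + k" by blast
    have "q = vx (Suc j) \<or> q = vx (j - 1) \<or> q = vx (j + k)"
      using neighbour_cases[of j q] j \<open>{p, q} \<in> wagner_edges n\<close> by auto
    then obtain i where i: "q = vx i" "a \<le> i \<and> i \<le> b \<or> a + k \<le> i \<and> i \<le> b + k"
    proof (elim disjE)
      assume "q = vx (Suc j)" then show thesis using j(2) that[of "Suc j"] by linarith
    next
      assume "q = vx (j - 1)" then show thesis using j(2) that[of "j - 1"] by linarith
    next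
      assume q: "q = vx (j + k)"
      show thesis
      proof (cases "j < b")
        case True
        then show thesis using j(2) that[of "j + k"] q by linarith
      next
        case False
        then have j': "a + k < j" "j < b + k" using j(2) by auto
        then have "q = vx (j - k)" using q vx_add_k_k[of "j - k"] by simp
        then show thesis using j' that[of "j - k"] by linarith
      qed
    qed
    moreover have "i \<noteq> a" "i \<noteq> b" "i \<noteq> a + k" "i \<noteq> b + k"
      using i(1) a b \<open>q \<in> S\<close> by auto
    ultimately have "a < i \<and> i < b \<or> a + k < i \<and> i < b + k" by linarith
    then show "q \<in> ?U" using i(1) \<open>q \<in> S\<close> by blast
  qed
  then obtain j where "vx v = vx j" "a < j \<and> j < b \<or> a + k < j \<and> j < b + k" by blast
  \<comment> \<open>By \<open>v < a\<close> and \<open>b < v + k\<close> both arcs lie strictly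
    between \<open>v\<close> and \<open>v + n\<close>, where no position names
    \<open>vx v\<close>.\<close>
  then show False using vx_inj_window[of v j] v sizes by auto
qed

lemma vx_in_Diff: "vx i \<in> wagner_verts n - S \<longleftrightarrow> vx i \<notin> S"
  using sizes by (auto simp: verts_window[of i])

lemma crossings_Diff: "crossings (wagner_verts n - S) a b = crossings S a b"
  unfolding crossings_def vx_in_Diff by blast

lemma card_crossings_split:
  assumes "a \<le> b" "b \<le> c"
  shows "card (crossings S a c) \<le> card (crossings S a b) + card (crossings S b c)"
proof -
  have "crossings S a c = crossings S a b \<union> crossings S b c"
    using assms by (auto simp: crossings_def)
  then show ?thesis by (simp add: card_Un_le)
qed

lemma card_crossings_quadrant:
  assumes con: "induced_connected (wagner_edges n) S"
    and con': "induced_connected (wagner_edges n) (wagner_verts n - S)"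
    and vw: "v < w" "w < v + k"
    and v: "vx v \<in> S" "vx (v + k) \<in> S" and w: "vx w \<notin> S" "vx (w + k) \<notin> S"
  shows "card (crossings S v w) \<le> 1"
  unfolding crossings_def
proof (rule card_changes_le_1)
  fix x y assume xy: "v \<le> x" "x < y" "y \<le> w" "(vx x \<in> S) = (vx w \<in> S)"
  show "(vx y \<in> S) = (vx w \<in> S)"
  proof (rule ccontr)
    assume "\<not> ?thesis"
    then have y: "vx y \<in> S" and x: "vx x \<notin> S" using xy w by auto
    have "x \<noteq> v" "y \<noteq> w" using x y v w by auto
    then have lt: "v < x" "y < w" using xy by auto
    \<comment> \<open>Positions \<open>x\<close> and \<open>w\<close> are outside \<open>S\<close>
      and enclose \<open>y\<close>; a path in \<open>S\<close> from \<open>y\<close> to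
      \<open>v\<close> supplies the chord at \<open>z\<close>.\<close>
    obtain z where z: "x < z" "z < w" "vx z \<in> S" "vx (z + k) \<in> S"
      using chord_in_open_arc[OF con x w(1) xy(2) lt(2) y v(1)] lt vw sizes by auto
    \<comment> \<open>With the sides swapped: \<open>v\<close> and \<open>z\<close> enclose
      \<open>x\<close>, which the complement must link to \<open>w\<close>.\<close>
    obtain z' where z': "v < z'" "z' < z" "vx z' \<notin> S" "vx (z' + k) \<notin> S"
      using chord_in_open_arc[OF con', of v z x w] lt vw sizes v(1) w(1) z x
      unfolding vx_in_Diff by auto
    show False
      using no_alternating_chords[OF con z'(3,4) w z'(2) z(2,3) z'(1) vw(2) v(1)] .
  qed
qed

text \<open>With no chord inside, an arc with both ends outside \<open>S\<close> cannot meet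
  \<open>S\<close> while \<open>S\<close> also has vertices beyond it. Hence \<open>S\<close> forms
  at most one arc of the cycle.\<close>

lemma card_outer_cut_no_chord:
  assumes con: "induced_connected (wagner_edges n) S"
    and no: "\<And>i. vx i \<in> S \<Longrightarrow> vx (i + k) \<notin> S"
  shows "card (outer_cycle n \<inter> cut (wagner_edges n) S) \<le> 2"
proof (cases "\<exists>t s. t < s \<and> s < t + n \<and> vx t \<notin> S \<and> vx s \<in> S")
  case True
  then obtain t s where ts: "t < s" "s < t + n" "vx t \<notin> S" "vx s \<in> S" by blast
  have "card (crossings S t s) \<le> 1"
    unfolding crossings_def
  proof (rule card_changes_le_1)
    fix x y assume xy: "t \<le> x" "x < y" "y \<le> s" "(vx x \<in> S) = (vx s \<in> S)"
    show "(vx y \<in> S) = (vx s \<in> S)"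
    proof (rule ccontr)
      assume "\<not> ?thesis"
      then have y: "vx y \<notin> S" and x: "vx x \<in> S" using xy ts by auto
      then have "x \<noteq> t" using ts by auto
      then show False
        using chord_in_open_arc[OF con ts(3) y, of x s] xy x ts no by auto
    qed
  qed
  moreover have "card (crossings S s (t + n)) \<le> 1"
    unfolding crossings_def
  proof (rule card_changes_le_1)
    fix x y assume xy: "s \<le> x" "x < y" "y \<le> t + n" "(vx x \<in> S) = (vx (t + n) \<in> S)"
    show "(vx y \<in> S) = (vx (t + n) \<in> S)"
    proof (rule ccontr)
      assume "\<not> ?thesis"
      then have y: "vx y \<in> S" and x: "vx x \<notin> S" using xy ts by auto
      then have "y \<noteq> t + n" using ts by auto
      then show False
        using chord_in_open_arc[OF con x, of "t + n" y s] xy y ts no by auto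
    qed
  qed
  ultimately show ?thesis
    using card_crossings_split[of t s "t + n" S] ts card_outer_cut[of S t] by simp
next
  case False
  have "crossings S 0 (0 + n) = {}"
  proof (rule ccontr)
    assume "crossings S 0 (0 + n) \<noteq> {}"
    then obtain i where "(vx i \<in> S) \<noteq> (vx (Suc i) \<in> S)" by (auto simp: crossings_def)
    moreover have "\<not> (vx i \<notin> S \<and> vx (Suc i) \<in> S)"
    proof -
      have "i < Suc i" "Suc i < i + n" using sizes by auto
      then show ?thesis using False by blast
    qed
    \<comment> \<open>A step out of \<open>S\<close> at \<open>i\<close> becomes a pair of the
      excluded kind by going on round the cycle to \<open>i + n\<close>.\<close>
    moreover have "\<not> (vx (Suc i) \<notin> S \<and> vx (i + n) \<in> S)"
    proof -
      have "Suc i < i + n" "i + n < Suc i + n" using sizes by auto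
      then show ?thesis using False by blast
    qed
    ultimately show False by simp
  qed
  then show ?thesis using card_outer_cut[of S 0] by simp
qed

lemma card_outer_bond_le_4:
  assumes sub: "S \<subseteq> wagner_verts n"
    and con: "induced_connected (wagner_edges n) S"
    and con': "induced_connected (wagner_edges n) (wagner_verts n - S)"
  shows "card (outer_cycle n \<inter> cut (wagner_edges n) S) \<le> 4"
proof -
  consider (noS) "\<And>i. vx i \<in> S \<Longrightarrow> vx (i + k) \<notin> S"
    | (noT) "\<And>i. vx i \<notin> S \<Longrightarrow> vx (i + k) \<in> S"
    | (both) v w where "vx v \<in> S" "vx (v + k) \<in> S" "vx w \<notin> S" "vx (w + k) \<notin> S"
    by blast
  then show ?thesis
  proof cases
    case noS
    then show ?thesis using card_outer_cut_no_chord[OF con] by fastforce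
  next
    case noT
    then have "card (outer_cycle n \<inter> cut (wagner_edges n) (wagner_verts n - S)) \<le> 2"
      by (intro card_outer_cut_no_chord[OF con']) (simp add: vx_in_Diff)
    then show ?thesis
      unfolding card_outer_cut[of _ 0] crossings_Diff by simp
  next
    case (both v w0)
    \<comment> \<open>Whether the chord at \<open>i\<close> avoids \<open>S\<close> has period
      \<open>k\<close> in \<open>i\<close>, so \<open>w0\<close> can be replaced by a
      \<open>w\<close> in the half-turn starting at \<open>v\<close>.\<close>
    define f where "f i \<longleftrightarrow> vx i \<notin> S \<and> vx (i + k) \<notin> S" for i
    have "f ` {v..<v + k} = range f"
      using k by (intro periodic_image_window) (auto simp: f_def)
    moreover have "f w0" using both by (simp add: f_def)
    ultimately have "True \<in> f ` {v..<v + k}" by (metis rangeI)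
    then obtain w where w: "v \<le> w" "w < v + k" "vx w \<notin> S" "vx (w + k) \<notin> S"
      by (auto simp: f_def)
    with both(1) have "v < w" by (metis le_neq_implies_less)
    note quadrant = card_crossings_quadrant[OF con con']
    have "wagner_verts n - (wagner_verts n - S) = S"
      using sub by blast
    \<comment> \<open>Two of the four arcs begin outside \<open>S\<close>; for them the bound is
      applied to the complement, whose crossings are the same.\<close>
    then have quadrant': "card (crossings S v w) \<le> 1"
      if "v < w" "w < v + k" "vx v \<notin> S" "vx (v + k) \<notin> S" "vx w \<in> S" "vx (w + k) \<in> S" for v w
      using card_crossings_quadrant[OF con', of v w] con that
      unfolding crossings_Diff vx_in_Diff by auto
    have nk: "v + n = v + k + k" using sizes by simp
    have "card (crossings S v w) \<le> 1"
      using \<open>v < w\<close> w both by (intro quadrant) auto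
    moreover have "card (crossings S (v + k) (w + k)) \<le> 1"
      using \<open>v < w\<close> w both by (intro quadrant) auto
    moreover have "card (crossings S w (v + k)) \<le> 1"
      using quadrant'[of w "v + k"] \<open>v < w\<close> w both by auto
    moreover have "card (crossings S (w + k) (v + n)) \<le> 1"
      using quadrant'[of "w + k" "v + n"] \<open>v < w\<close> w both
      unfolding nk by auto
    moreover have "card (crossings S v (v + n)) \<le> card (crossings S v w) + card (crossings S w (v + n))"
      "card (crossings S w (v + n)) \<le> card (crossings S w (v + k)) + card (crossings S (v + k) (v + n))"
      "card (crossings S (v + k) (v + n))
        \<le> card (crossings S (v + k) (w + k)) + card (crossings S (w + k) (v + n))"
      by (intro card_crossings_split; use \<open>v < w\<close> w(2) nk in linarith)+
    ultimately show ?thesis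
      unfolding card_outer_cut[of S v] by linarith
  qed
qed

section \<open>Tight bonds from two arcs\<close>

lemma arc_connected:
  assumes "i \<le> j" "\<And>l. i \<le> l \<Longrightarrow> l \<le> j \<Longrightarrow> vx l \<in> S"
  defines "R \<equiv> {(a, b). a \<in> S \<and> b \<in> S \<and> {a, b} \<in> wagner_edges n}\<^sup>*"
  shows "(vx i, vx j) \<in> R \<and> (vx j, vx i) \<in> R"
  using assms(1,2)
proof (induction j rule: dec_induct)
  case base
  then show ?case unfolding R_def by simp
next
  case (step m)
  have "vx m \<in> S" "vx (Suc m) \<in> S"
    using step by auto
  then have "(vx m, vx (Suc m)) \<in> R \<and> (vx (Suc m), vx m) \<in> R"
    unfolding R_def using cyc_in_edges[of m] by (auto simp: cyc_def insert_commute)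
  moreover have "(vx i, vx m) \<in> R \<and> (vx m, vx i) \<in> R"
    using step by auto
  ultimately show ?case
    unfolding R_def by (meson rtrancl_trans)
qed

text \<open>Each arc is a path of the cycle, and the chord at \<open>j\<close> joins the two, so
  \<open>vx j\<close> serves as hub.\<close>

lemma two_arcs_connected:
  assumes "j \<in> {a..<b}" "j + k \<in> {c..<d}"
  shows "induced_connected (wagner_edges n) (vx ` ({a..<b} \<union> {c..<d}))"
proof (rule induced_connected_hub[where h = "vx j"])
  let ?S = "vx ` ({a..<b} \<union> {c..<d})"
  let ?R = "{(a, b). a \<in> ?S \<and> b \<in> ?S \<and> {a, b} \<in> wagner_edges n}"
  fix u assume "u \<in> ?S"
  then consider i where "u = vx i" "i \<in> {a..<b}" | i where "u = vx i" "i \<in> {c..<d}" by blast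
  then show "(u, vx j) \<in> ?R\<^sup>*"
  proof cases
    case 1
    then show ?thesis
      using arc_connected[of i j ?S] arc_connected[of j i ?S] assms(1)
      by (cases "i \<le> j") auto
  next
    case 2
    then have "(u, vx (j + k)) \<in> ?R\<^sup>*"
      using arc_connected[of i "j + k" ?S] arc_connected[of "j + k" i ?S] assms(2)
      by (cases "i \<le> j + k") auto
    moreover have "(vx (j + k), vx j) \<in> ?R"
      using assms chd_in_edges[of j] by (auto simp: chd_def insert_commute)
    ultimately show ?thesis by (rule rtrancl_into_rtrancl)
  qed
qed

lemma vx_in_image_window:
  assumes "A \<subseteq> {v..<v + n}" "i \<in> {v..<v + n}"
  shows "vx i \<in> vx ` A \<longleftrightarrow> i \<in> A"
proof
  assume "vx i \<in> vx ` A"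
  then obtain j where "j \<in> A" "vx i = vx j" by auto
  then show "i \<in> A" using vx_inj_window[of i j] assms by fastforce
qed auto

text \<open>One side of a tight bond: arcs of lengths \<open>p\<close> and \<open>q\<close> starting
  at antipodal vertices. The values (1,1), (2,1) and (2,2) of \<open>(p, q)\<close> enter the
  dimension count.\<close>

definition two_arcs :: "nat \<Rightarrow> nat \<Rightarrow> nat \<Rightarrow> nat set" where
  "two_arcs v p q = vx ` ({v..<v + p} \<union> {v + k..<v + k + q})"

context
  fixes v p q :: nat
  assumes pq: "1 \<le> q" "q \<le> p" "p < k"
begin

text \<open>The position \<open>v + n\<close>, a second name for \<open>v\<close>, is included
  because the crossing test at \<open>v + n - 1\<close> looks at its successor.\<close>

lemma vx_in_two_arcs:
  assumes "i \<in> {v..v + n}"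
  shows "vx i \<in> two_arcs v p q \<longleftrightarrow> i < v + p \<or> v + k \<le> i \<and> i < v + k + q \<or> i = v + n"
proof (cases "i = v + n")
  case True
  then show ?thesis using pq by (auto simp: two_arcs_def)
next
  case False
  then have "vx i \<in> two_arcs v p q \<longleftrightarrow> i \<in> {v..<v + p} \<union> {v + k..<v + k + q}"
    unfolding two_arcs_def
  proof (intro vx_in_image_window)
    show "{v..<v + p} \<union> {v + k..<v + k + q} \<subseteq> {v..<v + n}"
      using pq sizes by auto
    show "i \<in> {v..<v + n}"
      using assms False by auto
  qed
  then show ?thesis using assms False by auto
qed

lemma two_arcs_bond:
  "is_bond (wagner_verts n) (wagner_edges n) (cut (wagner_edges n) (two_arcs v p q))"
proof -
  have "two_arcs v p q \<subseteq> wagner_verts n"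
    unfolding two_arcs_def verts_window[of v] using pq sizes by (intro image_mono) auto
  moreover have "induced_connected (wagner_edges n) (two_arcs v p q)"
    unfolding two_arcs_def using pq by (intro two_arcs_connected[of v]) auto
  moreover have "wagner_verts n - two_arcs v p q = vx ` ({v + p..<v + k} \<union> {v + k + q..<v + n})"
  proof -
    have "inj_on vx {v..<v + n}"
      by (auto intro!: inj_onI vx_inj_window)
    moreover have "{v..<v + p} \<union> {v + k..<v + k + q} \<subseteq> {v..<v + n}"
      using pq sizes by auto
    moreover have "{v..<v + n} - ({v..<v + p} \<union> {v + k..<v + k + q}) =
      {v + p..<v + k} \<union> {v + k + q..<v + n}"
      using pq sizes by auto
    ultimately show ?thesis
      unfolding two_arcs_def verts_window[of v] by (metis inj_on_image_set_diff Diff_subset)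
  qed
  \<comment> \<open>The complement is again two arcs; \<open>q \<le> p\<close> and
    \<open>p < k\<close> put both ends of the chord at \<open>v + p\<close> in it.\<close>
  moreover have "induced_connected (wagner_edges n) (vx ` ({v + p..<v + k} \<union> {v + k + q..<v + n}))"
    using pq sizes by (intro two_arcs_connected[of "v + p"]) auto
  ultimately show ?thesis
    unfolding is_bond_def by metis
qed

lemma crossings_two_arcs:
  "crossings (two_arcs v p q) v (v + n) = {v + p - 1, v + k - 1, v + k + q - 1, v + n - 1}"
proof -
  have "crossings (two_arcs v p q) v (v + n) =
    {i \<in> {v..<v + n}. (i < v + p \<or> v + k \<le> i \<and> i < v + k + q \<or> i = v + n) \<noteq>
      (Suc i < v + p \<or> v + k \<le> Suc i \<and> Suc i < v + k + q \<or> Suc i = v + n)}"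
    unfolding crossings_def by (intro Collect_cong conj_cong refl) (simp add: vx_in_two_arcs)
  also have "\<dots> = {v + p - 1, v + k - 1, v + k + q - 1, v + n - 1}"
    using pq sizes by auto
  finally show ?thesis .
qed

lemma two_arcs_distinct:
  "distinct [v + p - 1, v + k - 1, v + k + q - 1, v + n - 1]"
  using pq sizes by auto

lemma card_outer_two_arcs:
  "card (outer_cycle n \<inter> cut (wagner_edges n) (two_arcs v p q)) = 4"
  unfolding card_outer_cut[of _ v] crossings_two_arcs
  using distinct_card[OF two_arcs_distinct] by simp

text \<open>Chords before \<open>v + q\<close> join the two arcs, those from \<open>v + q\<close> up
  to \<open>v + p\<close> have one end in them, and later ones have none.\<close>

lemma sum_cut_two_arcs:
  fixes h :: "nat set \<Rightarrow> real"
  shows "sum h (cut (wagner_edges n) (two_arcs v p q)) =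
    h (cyc (v + p - 1)) + h (cyc (v + k - 1)) + h (cyc (v + k + q - 1)) + h (cyc (v + n - 1)) +
    (\<Sum>i\<in>{v + q..<v + p}. h (chd i))"
proof -
  have "{i \<in> {v..<v + k}. (vx i \<in> two_arcs v p q) \<noteq> (vx (i + k) \<in> two_arcs v p q)} =
    {v + q..<v + p}"
  proof -
    have "(vx i \<in> two_arcs v p q) \<noteq> (vx (i + k) \<in> two_arcs v p q) \<longleftrightarrow> v + q \<le> i \<and> i < v + p"
      if "i \<in> {v..<v + k}" for i
    proof -
      have "i \<in> {v..v + n}" "i + k \<in> {v..v + n}"
        using that sizes by auto
      from this[THEN vx_in_two_arcs] show ?thesis
        using that pq sizes by auto
    qed
    then have "{i \<in> {v..<v + k}. (vx i \<in> two_arcs v p q) \<noteq> (vx (i + k) \<in> two_arcs v p q)} =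
      {i \<in> {v..<v + k}. v + q \<le> i \<and> i < v + p}"
      by blast
    also have "\<dots> = {v + q..<v + p}"
      using pq by auto
    finally show ?thesis .
  qed
  then show ?thesis
    unfolding sum_cut[of h _ v] crossings_two_arcs using two_arcs_distinct by simp
qed

end

section \<open>The linear system of the tight bonds\<close>

text \<open>The equations make the cycle weights \<open>x\<close> antiperiodic under
  \<open>k\<close> and also constant, hence zero, and force the chord weights \<open>r\<close> to
  vanish along the way.\<close>

lemma edge_weights_zero:
  fixes h :: "nat set \<Rightarrow> real"
  assumes zero: "\<And>v p q. 1 \<le> q \<Longrightarrow> q \<le> p \<Longrightarrow> p < k \<Longrightarrow>
      sum h (cut (wagner_edges n) (two_arcs v p q)) = 0"
    and "e \<in> wagner_edges n"
  shows "h e = 0"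
proof -
  define x where "x i = h (cyc i)" for i
  define r where "r i = h (chd i)" for i
  have xn: "x (i + n) = x i" and rk: "r (i + k) = r i" for i
    by (simp_all add: x_def r_def)
  have xkk: "x (i + k + k) = x i" for i
    using xn[of i] by (simp add: n mult_2 add.assoc)
  have k1: "k > 2" using k by simp
  \<comment> \<open>Starting the arcs at \<open>u + 1\<close> makes the last crossing
    \<open>u + n\<close>, which is \<open>u\<close> again.\<close>
  have 11: "x (u + 1) + x (u + k) + x (u + k + 1) + x u = 0" for u
    using zero[of 1 1 "u + 1"] sum_cut_two_arcs[of 1 1 h "u + 1"] k1 xn[of u]
    by (simp add: x_def)
  have 22: "x (u + 2) + x (u + k) + x (u + k + 2) + x u = 0" for u
    using zero[of 2 2 "u + 1"] sum_cut_two_arcs[of 2 2 h "u + 1"] k1 xn[of u]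
    by (simp add: x_def)
  have 21: "x (u + 2) + x (u + k) + x (u + k + 1) + x u + r (u + 2) = 0" for u
    using zero[of 1 2 "u + 1"] sum_cut_two_arcs[of 1 2 h "u + 1"] k1 xn[of u]
    by (simp add: x_def r_def)
  \<comment> \<open>With \<open>g u = x u + x (u + k)\<close>, the first two families say \<open>g u = - g (u + 1) = - g (u + 2)\<close>.\<close>
  have anti: "x (u + k) = - x u" for u
    using 11[of u] 22[of u] 11[of "u + 1"] by (simp add: algebra_simps)
  \<comment> \<open>The third family at \<open>u\<close> and \<open>u + k\<close>: \<open>x\<close> changes sign, \<open>r\<close> does not.\<close>
  have step: "x (u + 2) = x (u + 1) \<and> r (u + 2) = 0" for u
    using 21[of u] 21[of "u + k"] anti[of u] anti[of "u + 1"] anti[of "u + 2"] rk[of "u + 2"] xkk[of u]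
      xkk[of "u + 1"]
    by (simp add: algebra_simps)
  have const: "x (u + 1) = x 1" for u
    by (induction u) (use step in auto)
  \<comment> \<open>Constancy gives \<open>x (k + 1) = x 1\<close>, antiperiodicity gives
    \<open>x (k + 1) = - x 1\<close>.\<close>
  have x1: "x 1 = 0"
    using const[of k] anti[of 1] by (simp add: add.commute)
  \<comment> \<open>\<open>const\<close> starts at index 1 and \<open>step\<close> reaches
    \<open>r\<close> only from index 2 on; shifting by a full period covers the small
    indices.\<close>
  have x0: "x i = 0" for i
    using xn[of i] const[of "i + n - 1"] x1 sizes by simp
  have r0: "r i = 0" for i
    using rk[of i] step[of "i + k - 2"] k by (simp add: Suc_diff_Suc numeral_2_eq_2)
  show ?thesis
    using assms(2) x0 r0 unfolding edges_window[of 0] x_def r_def by auto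
qed

end

section \<open>Incidence vectors and the facet\<close>

lemma inner_incidence_vec:
  assumes "inj_on ix D"
  shows "a \<bullet> incidence_vec ix D = (\<Sum>e\<in>D. a $ ix e)"
proof -
  have "a \<bullet> incidence_vec ix D = (\<Sum>j\<in>UNIV. if j \<in> ix ` D then a $ j else 0)"
    unfolding inner_vec_def incidence_vec_def by (intro sum.cong) auto
  also have "\<dots> = (\<Sum>j\<in>ix ` D. a $ j)"
    by (simp add: sum.If_cases)
  also have "\<dots> = (\<Sum>e\<in>D. a $ ix e)"
    using assms by (simp add: sum.reindex)
  finally show ?thesis .
qed

lemma inner_incidence_vec_incidence_vec:
  assumes "inj_on ix E" "finite E" "C \<subseteq> E" "D \<subseteq> E"
  shows "incidence_vec ix C \<bullet> incidence_vec ix D = card (C \<inter> D)"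
proof -
  have "incidence_vec ix C \<bullet> incidence_vec ix D = (\<Sum>e\<in>D. incidence_vec ix C $ ix e)"
    using assms by (intro inner_incidence_vec) (rule inj_on_subset)
  also have "\<dots> = (\<Sum>e\<in>D. if e \<in> C then 1 else 0)"
    using assms by (intro sum.cong) (auto simp: incidence_vec_def dest: inj_onD)
  also have "\<dots> = card (C \<inter> D)"
    using finite_subset[OF assms(4,2)] by (simp add: sum.If_cases Int_commute)
  finally show ?thesis .
qed

theorem theorem7p2:
  fixes n :: nat and ix :: "nat set \<Rightarrow> 'e::finite"
  assumes "n \<ge> 6" and "even n"
    and "bij_betw ix (wagner_edges n) (UNIV :: 'e set)"
  shows "defines_facet (\<lambda>x :: real ^ 'e. \<Sum>e\<in>outer_cycle n. x $ ix e) 4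
           (bond_polytope ix (wagner_verts n) (wagner_edges n))"
proof -
  interpret wagner "n div 2" n
    using assms by unfold_locales auto
  let ?V = "wagner_verts n" and ?E = "wagner_edges n"
  define P where "P = bond_polytope ix ?V ?E"
  define c where "c = incidence_vec ix (outer_cycle n)"
  have inj: "inj_on ix ?E" and surj: "ix ` ?E = UNIV"
    using assms(3) by (auto simp: bij_betw_def)
  have f_eq: "(\<Sum>e\<in>outer_cycle n. x $ ix e) = c \<bullet> x" for x :: "real ^ 'e"
    unfolding c_def using inner_incidence_vec[of ix "outer_cycle n" x]
      inj_on_subset[OF inj outer_subset_edges] by (simp add: inner_commute)
  have cut_sub: "cut ?E S \<subseteq> ?E" for S
    by (auto simp: cut_def)
  have c_cut: "c \<bullet> incidence_vec ix (cut ?E S) = card (outer_cycle n \<inter> cut ?E S)" for S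
    unfolding c_def
    by (rule inner_incidence_vec_incidence_vec[OF inj finite_edges outer_subset_edges cut_sub])
  have in_P: "incidence_vec ix D \<in> P" if "is_bond ?V ?E D" for D
    unfolding P_def bond_polytope_def using that by (intro hull_inc) auto
  \<comment> \<open>A halfspace is convex, so the bound need only be checked on bonds.\<close>
  have "P \<subseteq> {x. c \<bullet> x \<le> 4}"
    unfolding P_def bond_polytope_def
  proof (rule hull_minimal)
    show "{incidence_vec ix D | D. is_bond ?V ?E D} \<subseteq> {x. c \<bullet> x \<le> 4}"
      using card_outer_bond_le_4 unfolding is_bond_def by (auto simp: c_cut)
  qed (rule convex_halfspace_le)
  then have le: "c \<bullet> x \<le> 4" if "x \<in> P" for x
    using that by auto
  have "{x \<in> P. c \<bullet> x = 4} facet_of P"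
  proof (rule facet_of_supporting_hyperplane)
    show "convex P"
      unfolding P_def bond_polytope_def by (rule convex_convex_hull)
    \<comment> \<open>The point off the hyperplane is the empty cut, a bond because the whole graph
      is connected: take the full cycle as both arcs.\<close>
    have "induced_connected ?E (vx ` ({0..<n} \<union> {0..<n}))"
      using assms(1) by (intro two_arcs_connected[of 0]) auto
    then have "induced_connected ?E ?V"
      by (simp add: verts_window[of 0])
    then show "incidence_vec ix (cut ?E {}) \<in> P"
      by (intro in_P) (auto simp: is_bond_def induced_connected_def)
    show "c \<bullet> incidence_vec ix (cut ?E {}) \<noteq> 4"
      unfolding c_cut by (simp add: cut_def)
  next
    fix a assume orth: "\<And>x. x \<in> P \<Longrightarrow> c \<bullet> x = 4 \<Longrightarrow> a \<bullet> x = 0"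
    have "a $ ix e = 0" if "e \<in> ?E" for e
    proof (rule edge_weights_zero[OF _ that, where h = "\<lambda>e. a $ ix e"])
      fix v p q assume pq: "1 \<le> q" "q \<le> p" "p < n div 2"
      have "a \<bullet> incidence_vec ix (cut ?E (two_arcs v p q)) = 0"
        using two_arcs_bond[OF pq] card_outer_two_arcs[OF pq] by (intro orth in_P) (simp_all add: c_cut)
      then show "(\<Sum>e\<in>cut ?E (two_arcs v p q). a $ ix e) = 0"
        using inner_incidence_vec[of ix "cut ?E (two_arcs v p q)" a] inj_on_subset[OF inj cut_sub]
        by simp
    qed
    then show "a = 0"
      using surj by (auto simp: vec_eq_iff) (metis UNIV_I imageE)
  qed (rule le)
  then show ?thesis
    unfolding defines_facet_def f_eq P_def[symmetric] using le by blast
qed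

end
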